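(* Let $\alpha>-1$, let $n$ be a positive integer, let $\psi$ be an analytic function on $\mathbb{D}$ that is not identically $0$, and let $\varphi$ be a nonconstant analytic self-map of $\mathbb{D}$. Suppose that $D_{\psi,\varphi,n}$ is bounded on $A_\alpha^2$. Then $D_{\psi,\varphi,n}$ is self-adjoint on $A_\alpha^2$ if and only if $$\psi(z)=\frac{az^n}{n!\,(1-\overline{c}z)^{n+\alpha+2}}=\frac{a}{t\,n!}K_c^{(n)}(z)\qquad\text{and}\qquad \varphi(z)=c+\frac{bz}{1-\overline{c}z}\qquad(z\in\mathbb{D}),$$ where $a=\psi^{(n)}(0)$ and $b=\varphi'(0)$ are both nonzero real numbers and $c=\varphi(0)$ belongs to $\mathbb{D}$. Furthermore, if $D_{\psi,\varphi,n}$ is self-adjoint (with $c=\varphi(0)$), then: (i) if $c=0$, then $D_{\psi,\varphi,n}$ is $J$-symmetric; (ii) if $c\neq0$, then $D_{\psi,\varphi,n}$ is $C_{e^{-2i\theta}z}J$-symmetric, where $\theta=\mathrm{Arg}(c)$.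
   Context: $\mathbb{D}$ is the open unit disk in $\mathbb{C}$. For $\alpha>-1$, the weighted Bergman space $A_\alpha^2$ is the Hilbert space of analytic functions $f(z)=\sum_{j\ge0}a_jz^j$ on $\mathbb{D}$ with $\|f\|^2=\sum_{j\ge0}|a_j|^2\beta(j)^2<\infty$, where $\beta(j)^2=\frac{j!\,\Gamma(\alpha+2)}{\Gamma(j+\alpha+2)}$, with inner product $\langle\sum a_jz^j,\sum b_jz^j\rangle=\sum a_j\overline{b_j}\beta(j)^2$. For $w\in\mathbb{D}$ and an integer $m\ge0$, $K_w^{(m)}\in A_\alpha^2$ is the function with $\langle f,K_w^{(m)}\rangle=f^{(m)}(w)$ for all $f\in A_\alpha^2$; explicitly $K_w^{(m)}(z)=\frac{(\alpha+2)\cdots(\alpha+m+1)z^m}{(1-\overline{w}z)^{m+\alpha+2}}$. Non-integer powers use the principal branch. Put $t=(\alpha+2)(\alpha+3)\cdots(\alpha+n+1)$. The weighted composition--differentiation operator of order $n$ is $D_{\psi,\varphi,n}f=\psi\cdot(f^{(n)}\circ\varphi)$. For $|\lambda|=1$, $C_{\lambda z}$ is the composition operator $(C_{\lambda z}f)(z)=f(\lambda z)$. A conjugation on a complex Hilbert space is an antilinear isometric involution $C$; a bounded operator $T$ is $C$-symmetric if $CT^*C=T$. $J$ is the conjugation $(Jf)(z)=\overline{f(\overline{z})}$; $C_{\lambda z}J$ is also a conjugation for $|\lambda|=1$. $\mathrm{Arg}(c)\in[0,2\pi)$ is the argument of $c$, so $c=|c|e^{i\,\mathrm{Arg}(c)}$.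 *)

theory Defs
  imports "HOL-Complex_Analysis.Complex_Analysis"
begin

definition bergman_weight :: "real \<Rightarrow> nat \<Rightarrow> real" where
  "bergman_weight \<alpha> j = fact j * Gamma (\<alpha> + 2) / Gamma (real j + \<alpha> + 2)"

definition taylor_coeff :: "(complex \<Rightarrow> complex) \<Rightarrow> nat \<Rightarrow> complex" where
  "taylor_coeff f j = (deriv ^^ j) f 0 / fact j"

text \<open>
  A function on the unit disk is represented by its extension by \<open>0\<close> to the whole plane, so that
  equality of elements of the space is equality in HOL.
\<close>

definition bergman_space :: "real \<Rightarrow> (complex \<Rightarrow> complex) set" where
  "bergman_space \<alpha> = {f. f holomorphic_on ball 0 1 \<and> (\<forall>z. z \<notin> ball 0 1 \<longrightarrow> f z = 0) \<and>
     summable (\<lambda>j. (cmod (taylor_coeff f j))\<^sup>2 * bergman_weight \<alpha> j)}"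

definition bergman_norm :: "real \<Rightarrow> (complex \<Rightarrow> complex) \<Rightarrow> real" where
  "bergman_norm \<alpha> f = sqrt (\<Sum>j. (cmod (taylor_coeff f j))\<^sup>2 * bergman_weight \<alpha> j)"

definition bergman_inner :: "real \<Rightarrow> (complex \<Rightarrow> complex) \<Rightarrow> (complex \<Rightarrow> complex) \<Rightarrow> complex" where
  "bergman_inner \<alpha> f g =
     (\<Sum>j. taylor_coeff f j * cnj (taylor_coeff g j) * of_real (bergman_weight \<alpha> j))"

definition bergman_kernel :: "real \<Rightarrow> complex \<Rightarrow> nat \<Rightarrow> complex \<Rightarrow> complex" where
  "bergman_kernel \<alpha> w m =
     (THE K. K \<in> bergman_space \<alpha> \<and>
        (\<forall>f\<in>bergman_space \<alpha>. bergman_inner \<alpha> f K = (deriv ^^ m) f w))"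

type_synonym operator = "(complex \<Rightarrow> complex) \<Rightarrow> (complex \<Rightarrow> complex)"

definition bounded_operator :: "real \<Rightarrow> operator \<Rightarrow> bool" where
  "bounded_operator \<alpha> T \<longleftrightarrow>
     (\<forall>f\<in>bergman_space \<alpha>. T f \<in> bergman_space \<alpha>) \<and>
     (\<forall>f\<in>bergman_space \<alpha>. \<forall>g\<in>bergman_space \<alpha>. \<forall>p q.
        T (\<lambda>z. p * f z + q * g z) = (\<lambda>z. p * T f z + q * T g z)) \<and>
     (\<exists>M. \<forall>f\<in>bergman_space \<alpha>. bergman_norm \<alpha> (T f) \<le> M * bergman_norm \<alpha> f)"

text \<open>\<open>S\<close> is the adjoint of \<open>T\<close>; the values of such an \<open>S\<close> on the space are unique.\<close>

definition is_adjoint :: "real \<Rightarrow> operator \<Rightarrow> operator \<Rightarrow> bool" where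
  "is_adjoint \<alpha> T S \<longleftrightarrow>
     (\<forall>g\<in>bergman_space \<alpha>. S g \<in> bergman_space \<alpha>) \<and>
     (\<forall>f\<in>bergman_space \<alpha>. \<forall>g\<in>bergman_space \<alpha>.
        bergman_inner \<alpha> (T f) g = bergman_inner \<alpha> f (S g))"

definition self_adjoint :: "real \<Rightarrow> operator \<Rightarrow> bool" where
  "self_adjoint \<alpha> T \<longleftrightarrow> bounded_operator \<alpha> T \<and> is_adjoint \<alpha> T T"

definition conjugation :: "real \<Rightarrow> operator \<Rightarrow> bool" where
  "conjugation \<alpha> C \<longleftrightarrow>
     (\<forall>f\<in>bergman_space \<alpha>. C f \<in> bergman_space \<alpha>) \<and>
     (\<forall>f\<in>bergman_space \<alpha>. \<forall>g\<in>bergman_space \<alpha>. \<forall>p q.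
        C (\<lambda>z. p * f z + q * g z) = (\<lambda>z. cnj p * C f z + cnj q * C g z)) \<and>
     (\<forall>f\<in>bergman_space \<alpha>. bergman_norm \<alpha> (C f) = bergman_norm \<alpha> f) \<and>
     (\<forall>f\<in>bergman_space \<alpha>. C (C f) = f)"

definition C_symmetric :: "real \<Rightarrow> operator \<Rightarrow> operator \<Rightarrow> bool" where
  "C_symmetric \<alpha> C T \<longleftrightarrow>
     conjugation \<alpha> C \<and> bounded_operator \<alpha> T \<and>
     (\<exists>S. is_adjoint \<alpha> T S \<and> (\<forall>f\<in>bergman_space \<alpha>. C (S (C f)) = T f))"

definition comp_diff_op :: "(complex \<Rightarrow> complex) \<Rightarrow> (complex \<Rightarrow> complex) \<Rightarrow> nat \<Rightarrow> operator" where
  "comp_diff_op \<psi> \<phi> n f =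
     (\<lambda>z. if z \<in> ball 0 1 then \<psi> z * (deriv ^^ n) f (\<phi> z) else 0)"

definition rotation_op :: "complex \<Rightarrow> operator" where
  "rotation_op \<mu> f = (\<lambda>z. f (\<mu> * z))"

definition J_op :: operator where
  "J_op f = (\<lambda>z. cnj (f (cnj z)))"

end

theory Submission
  imports Defs
begin

text \<open>
  A bounded operator \<open>T\<close> is self-adjoint iff \<open>\<langle>T K\<^sub>w, K\<^sub>z\<rangle> = (T K\<^sub>w) z\<close> is Hermitian in
  \<open>(z, w)\<close>. For a composition-differentiation operator this function is a real multiple of
  \<open>\<psi> z * cnj w ^ n / (1 - cnj w * \<phi> z) powr s\<close> with \<open>s = n + \<alpha> + 2\<close>. If it is Hermitian, then
  \<open>\<psi> z = z ^ n * \<omega> z\<close> for some holomorphic \<open>\<omega>\<close>, and cancelling \<open>(z * cnj w) ^ n\<close> reduces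
  everything to \<open>n = 0\<close>. Putting \<open>w = 0\<close> then determines \<open>\<omega>\<close>, and differentiating in \<open>z\<close> at
  \<open>0\<close> determines \<open>\<phi>\<close>; no \<open>s\<close>-th root has to be taken. Conversely, the map
  \<open>\<phi> z = c + b * z / (1 - cnj c * z)\<close> with real \<open>b\<close> satisfies
  \<open>(1 - cnj c * z) * (1 - cnj w * \<phi> z) = (1 - cnj w * c) * (1 - cnj (\<phi> w) * z)\<close>,
  and raising this to the power \<open>s\<close> gives the Hermitian symmetry.
\<close>

section \<open>Taylor coefficients\<close>

lemma taylor_coeff_eqI:
  assumes "r > 0" and sums: "\<And>z. z \<in> ball 0 r \<Longrightarrow> (\<lambda>j. a j * z ^ j) sums f z"
  shows "taylor_coeff f j = a j"
proof -
  have "\<forall>\<^sub>F z in nhds 0. (\<lambda>j. a j * z ^ j) sums f z"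
    using assms by (intro eventually_nhds_in_open[THEN eventually_mono, of "ball 0 r"]) auto
  then have "f has_fps_expansion Abs_fps a"
    by (intro has_fps_expansionI) simp
  from fps_nth_fps_expansion[OF this, of j] show ?thesis
    by (simp add: taylor_coeff_def)
qed

lemma taylor_coeff_sums:
  assumes "f holomorphic_on ball 0 r" "z \<in> ball 0 r"
  shows "(\<lambda>j. taylor_coeff f j * z ^ j) sums f z"
  using holomorphic_power_series[OF assms] by (simp add: taylor_coeff_def)

lemma higher_deriv_taylor_sums:
  assumes "f holomorphic_on ball 0 r" "z \<in> ball 0 r"
  shows "(\<lambda>i. taylor_coeff f (i + m) * (fact (i + m) / fact i) * z ^ i) sums (deriv ^^ m) f z"
proof -
  have "(deriv ^^ m) f holomorphic_on ball 0 r"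
    using assms by (intro holomorphic_higher_deriv) auto
  from taylor_coeff_sums[OF this assms(2)] show ?thesis
    by (simp add: taylor_coeff_def funpow_add)
qed

lemma taylor_coeff_lincomb:
  assumes "f analytic_on {0}" "g analytic_on {0}"
  shows "taylor_coeff (\<lambda>z. p * f z + q * g z) j = p * taylor_coeff f j + q * taylor_coeff g j"
  using assms unfolding taylor_coeff_def
  by (subst higher_deriv_add_at)
    (auto simp: higher_deriv_cmult' add_divide_distrib intro!: analytic_intros)

lemma taylor_coeff_power_mult:
  assumes \<omega>: "\<omega> holomorphic_on ball 0 r" and "r > 0"
    and f: "\<And>z. z \<in> ball 0 r \<Longrightarrow> f z = z ^ n * \<omega> z"
  shows "taylor_coeff f n = \<omega> 0"
proof -
  have "\<omega> analytic_on {0}"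
    using assms(1,2) by (intro holomorphic_on_imp_analytic_at[OF \<omega>]) auto
  then have "(\<lambda>z. z ^ n * \<omega> z) has_fps_expansion fps_X ^ n * fps_expansion \<omega> 0"
    by (intro has_fps_expansion_mult has_fps_expansion_fps_X_power
        analytic_at_imp_has_fps_expansion_0)
  from fps_nth_fps_expansion[OF this, of n]
  have "taylor_coeff (\<lambda>z. z ^ n * \<omega> z) n = \<omega> 0"
    by (simp add: taylor_coeff_def fps_X_power_mult_nth fps_expansion_def)
  moreover have "(deriv ^^ n) f 0 = (deriv ^^ n) (\<lambda>z. z ^ n * \<omega> z) 0"
    using eventually_nhds_in_open[of "ball 0 r" 0] f \<open>r > 0\<close>
    by (intro higher_deriv_cong_ev refl) (auto elim: eventually_mono)
  ultimately show ?thesis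
    by (simp add: taylor_coeff_def)
qed

lemma higher_deriv_cnj_cnj:
  assumes f: "f holomorphic_on A" and A: "open A" and "cnj z \<in> A"
  shows "(deriv ^^ m) (\<lambda>w. cnj (f (cnj w))) z = cnj ((deriv ^^ m) f (cnj z))"
  using \<open>cnj z \<in> A\<close>
proof (induction m arbitrary: z)
  case (Suc m)
  have "open (cnj -` A)"
    using A by (intro open_vimage continuous_intros)
  then have "\<forall>\<^sub>F w in nhds z. w \<in> cnj -` A"
    using Suc.prems by (intro eventually_nhds_in_open) auto
  then have "\<forall>\<^sub>F w in nhds z. (deriv ^^ m) (\<lambda>w. cnj (f (cnj w))) w = (cnj \<circ> (deriv ^^ m) f \<circ> cnj) w"
    by eventually_elim (simp add: Suc.IH)
  then have "deriv ((deriv ^^ m) (\<lambda>w. cnj (f (cnj w)))) z = deriv (cnj \<circ> (deriv ^^ m) f \<circ> cnj) z"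
    by (intro deriv_cong_ev refl)
  also have "\<dots> = cnj (deriv ((deriv ^^ m) f) (cnj z))"
    using Suc.prems A
    by (intro DERIV_imp_deriv has_field_derivative_cnj_cnj holomorphic_derivI[of _ A]
        holomorphic_higher_deriv f) auto
  finally show ?case by simp
qed simp

section \<open>Hermitian symbol kernels\<close>

definition hermitian_on :: "'a set \<Rightarrow> ('a \<Rightarrow> 'a \<Rightarrow> complex) \<Rightarrow> bool" where
  "hermitian_on S M \<longleftrightarrow> (\<forall>z\<in>S. \<forall>w\<in>S. M z w = cnj (M w z))"

lemma hermitian_onD: "hermitian_on S M \<Longrightarrow> z \<in> S \<Longrightarrow> w \<in> S \<Longrightarrow> M z w = cnj (M w z)"
  unfolding hermitian_on_def by blast

lemma hermitian_on_if_hermitian_on_punctured: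
  fixes p :: "'a :: {perfect_space, t2_space}"
  assumes "open S" "p \<in> S" and herm: "hermitian_on (S - {p}) M"
    and cont: "\<And>w. w \<in> S \<Longrightarrow> continuous_on S (\<lambda>z. M z w)"
      "\<And>z. z \<in> S \<Longrightarrow> continuous_on S (\<lambda>w. M z w)"
  shows "hermitian_on S M"
proof -
  have extend: "M p w = cnj (M w p)"
    if w: "w \<in> S" and eq: "\<And>z. z \<in> S - {p} \<Longrightarrow> M z w = cnj (M w z)" for w
  proof -
    have lim: "((\<lambda>z. M z w) \<longlongrightarrow> M p w) (at p)" "((\<lambda>z. cnj (M w z)) \<longlongrightarrow> cnj (M w p)) (at p)"
      using cont[OF w] assms(1,2)
      by (auto simp: continuous_on_eq_continuous_at isCont_def intro: tendsto_cnj)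
    have "\<forall>\<^sub>F z in at p. M z w = cnj (M w z)"
      using eventually_at_in_open[OF assms(1,2)] eq by (auto elim: eventually_mono)
    from Lim_transform_eventually[OF lim(1) this] show ?thesis
      using lim(2) by (rule tendsto_unique[OF at_neq_bot])
  qed
  have away_from_p: "M z w = cnj (M w z)" if "z \<in> S" "w \<in> S - {p}" for z w
    using extend[of w] hermitian_onD[OF herm] that by (cases "z = p") blast+
  moreover have "M z p = cnj (M p z)" if "z \<in> S" for z
  proof (cases "z = p")
    case True
    have "M u p = cnj (M p u)" if "u \<in> S - {p}" for u
      using away_from_p[OF \<open>p \<in> S\<close> that] by simp
    then show ?thesis
      unfolding True by (rule extend[OF \<open>p \<in> S\<close>])
  next
    case False
    then show ?thesis
      using away_from_p[of p z] that \<open>p \<in> S\<close> by simp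
  qed
  ultimately show ?thesis
    unfolding hermitian_on_def by blast
qed

definition kernel_denom :: "real \<Rightarrow> complex \<Rightarrow> complex \<Rightarrow> complex" where
  "kernel_denom s u v = (1 - cnj u * v) powr of_real s"

definition symbol_kernel ::
    "real \<Rightarrow> nat \<Rightarrow> (complex \<Rightarrow> complex) \<Rightarrow> (complex \<Rightarrow> complex) \<Rightarrow> complex \<Rightarrow> complex \<Rightarrow> complex" where
  "symbol_kernel s n \<psi> \<phi> z w = \<psi> z * cnj w ^ n / kernel_denom s w (\<phi> z)"

definition weight_symbol :: "real \<Rightarrow> nat \<Rightarrow> complex \<Rightarrow> complex \<Rightarrow> complex \<Rightarrow> complex" where
  "weight_symbol s n L c z = L * z ^ n / kernel_denom s c z"

definition moebius_symbol :: "complex \<Rightarrow> complex \<Rightarrow> complex \<Rightarrow> complex" where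
  "moebius_symbol c b z = c + b * z / (1 - cnj c * z)"

lemma norm_cnj_mult_less_1:
  assumes "u \<in> ball 0 1" "v \<in> ball 0 1"
  shows "cmod (cnj u * v) < 1"
  using assms mult_strict_mono'[of "cmod u" 1 "cmod v" 1] by (simp add: norm_mult)

lemma Re_one_minus_cnj_mult_pos:
  assumes "u \<in> ball 0 1" "v \<in> ball 0 1"
  shows "Re (1 - cnj u * v) > 0"
  using norm_cnj_mult_less_1[OF assms] complex_Re_le_cmod[of "cnj u * v"] by simp

lemma one_minus_cnj_mult_nonzero:
  assumes "u \<in> ball 0 1" "v \<in> ball 0 1"
  shows "1 - cnj u * v \<noteq> 0"
  using Re_one_minus_cnj_mult_pos[OF assms] by force

lemma one_minus_cnj_mult_notin_nonpos_Reals: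
  assumes "u \<in> ball 0 1" "v \<in> ball 0 1"
  shows "1 - cnj u * v \<notin> \<real>\<^sub>\<le>\<^sub>0"
  using Re_one_minus_cnj_mult_pos[OF assms] by (auto simp: complex_nonpos_Reals_iff)

lemma kernel_denom_nonzero:
  assumes "u \<in> ball 0 1" "v \<in> ball 0 1"
  shows "kernel_denom s u v \<noteq> 0"
  using one_minus_cnj_mult_nonzero[OF assms] by (simp add: kernel_denom_def)

lemma cnj_kernel_denom:
  assumes "u \<in> ball 0 1" "v \<in> ball 0 1"
  shows "cnj (kernel_denom s u v) = kernel_denom s v u"
  using Re_one_minus_cnj_mult_pos[OF assms] unfolding kernel_denom_def
  by (subst cnj_powr) (auto simp: mult.commute)

lemma kernel_denom_0 [simp]: "kernel_denom s 0 v = 1" "kernel_denom s u 0 = 1"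
  by (simp_all add: kernel_denom_def)

lemma kernel_denom_has_field_derivative:
  assumes "(f has_field_derivative f') (at x)" "u \<in> ball 0 1" "f x \<in> ball 0 1"
  shows "((\<lambda>z. kernel_denom s u (f z)) has_field_derivative
    - of_real s * cnj u * f' * kernel_denom s u (f x) / (1 - cnj u * f x)) (at x)"
proof -
  have "((\<lambda>z. kernel_denom s u (f z)) has_field_derivative
      of_real s * (1 - cnj u * f x) powr (of_real s - 1) * (- (cnj u * f'))) (at x)"
    unfolding kernel_denom_def using one_minus_cnj_mult_notin_nonpos_Reals[OF assms(2,3)]
    by (intro has_field_derivative_powr[THEN DERIV_chain2])
      (auto intro!: derivative_eq_intros assms(1))
  then show ?thesis
    using one_minus_cnj_mult_nonzero[OF assms(2,3)]
    by (simp add: kernel_denom_def powr_diff mult_ac)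
qed

lemma kernel_denom_holomorphic:
  assumes "f holomorphic_on A" "open A" "f ` A \<subseteq> ball 0 1" "u \<in> ball 0 1"
  shows "(\<lambda>z. kernel_denom s u (f z)) holomorphic_on A"
  using assms kernel_denom_has_field_derivative[OF holomorphic_derivI[OF assms(1,2)] assms(4)]
  by (subst holomorphic_on_open) (auto simp: image_subset_iff)

lemma hermitian_symbol_kernel_factor:
  assumes herm: "hermitian_on (ball 0 1) (symbol_kernel s n \<psi> \<phi>)"
    and \<phi>: "\<phi> holomorphic_on ball 0 1" "\<phi> ` ball 0 1 \<subseteq> ball 0 1"
  obtains \<omega> where "\<omega> holomorphic_on ball 0 1" "\<And>z. z \<in> ball 0 1 \<Longrightarrow> \<psi> z = z ^ n * \<omega> z"
proof -
  define u :: complex where "u = 1 / 2"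
  have u: "u \<in> ball 0 1" "cnj u = u" "u \<noteq> 0" by (simp_all add: u_def)
  have \<phi>u_in_ball: "\<phi> u \<in> ball 0 1" using \<phi>(2) u(1) by blast
  define \<omega> where "\<omega> z = cnj (\<psi> u) * kernel_denom s u (\<phi> z) / (u ^ n * kernel_denom s (\<phi> u) z)" for z
  have "\<omega> holomorphic_on ball 0 1"
    unfolding \<omega>_def using u kernel_denom_nonzero[OF \<phi>u_in_ball]
    by (intro holomorphic_intros kernel_denom_holomorphic[OF \<phi>(1)] \<phi>(2)
        kernel_denom_holomorphic[OF holomorphic_on_ident] \<phi>u_in_ball) auto
  moreover have "\<psi> z = z ^ n * \<omega> z" if z: "z \<in> ball 0 1" for z
  proof -
    have "\<phi> z \<in> ball 0 1" using \<phi>(2) z by blast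
    moreover have "\<psi> z * u ^ n / kernel_denom s u (\<phi> z)
        = cnj (\<psi> u) * z ^ n / kernel_denom s (\<phi> u) z"
      using hermitian_onD[OF herm z u(1)] u(2) z \<phi>u_in_ball
      by (simp add: symbol_kernel_def cnj_kernel_denom)
    ultimately show ?thesis
      using u z \<phi>u_in_ball kernel_denom_nonzero by (simp add: \<omega>_def field_simps)
  qed
  ultimately show ?thesis using that by blast
qed

lemma symbol_kernel_power_mult:
  assumes "\<psi> z = z ^ n * \<omega> z"
  shows "symbol_kernel s n \<psi> \<phi> z w = (z * cnj w) ^ n * symbol_kernel s 0 \<omega> \<phi> z w"
  using assms by (simp add: symbol_kernel_def power_mult_distrib)

lemma symbol_kernel_continuous_on_left:
  assumes \<phi>: "\<phi> holomorphic_on ball 0 1" "\<phi> ` ball 0 1 \<subseteq> ball 0 1"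
    and \<psi>: "\<psi> holomorphic_on ball 0 1" and w: "w \<in> ball 0 1"
  shows "continuous_on (ball 0 1) (\<lambda>z. symbol_kernel s n \<psi> \<phi> z w)"
proof -
  have "(\<lambda>z. symbol_kernel s n \<psi> \<phi> z w) holomorphic_on ball 0 1"
    unfolding symbol_kernel_def using \<phi>(2) w
    by (intro holomorphic_intros \<psi> kernel_denom_holomorphic[OF \<phi>(1)] kernel_denom_nonzero)
      (auto simp: image_subset_iff)
  then show ?thesis
    by (rule holomorphic_on_imp_continuous_on)
qed

lemma symbol_kernel_continuous_on_right:
  assumes "\<phi> z \<in> ball 0 1"
  shows "continuous_on (ball 0 1) (\<lambda>w. symbol_kernel s n \<psi> \<phi> z w)"
proof -
  have "continuous_on (ball 0 1) (kernel_denom s (\<phi> z))"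
    by (intro holomorphic_on_imp_continuous_on
        kernel_denom_holomorphic[OF holomorphic_on_ident] assms) auto
  then have "continuous_on (ball 0 1) (\<lambda>w. \<psi> z * cnj w ^ n / cnj (kernel_denom s (\<phi> z) w))"
    using kernel_denom_nonzero[OF assms] by (intro continuous_intros) auto
  then show ?thesis
    by (rule continuous_on_eq) (simp add: symbol_kernel_def cnj_kernel_denom[OF assms])
qed

lemma hermitian_symbol_kernel_cancel_power:
  assumes herm: "hermitian_on (ball 0 1) (symbol_kernel s n \<psi> \<phi>)"
    and \<phi>: "\<phi> holomorphic_on ball 0 1" "\<phi> ` ball 0 1 \<subseteq> ball 0 1"
    and \<omega>: "\<omega> holomorphic_on ball 0 1" and \<psi>: "\<And>z. z \<in> ball 0 1 \<Longrightarrow> \<psi> z = z ^ n * \<omega> z"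
  shows "hermitian_on (ball 0 1) (symbol_kernel s 0 \<omega> \<phi>)"
proof (rule hermitian_on_if_hermitian_on_punctured)
  let ?M = "symbol_kernel s 0 \<omega> \<phi>"
  show "hermitian_on (ball 0 1 - {0}) ?M"
    unfolding hermitian_on_def
  proof (intro ballI)
    fix z w :: complex assume z: "z \<in> ball 0 1 - {0}" and w: "w \<in> ball 0 1 - {0}"
    then have "symbol_kernel s n \<psi> \<phi> z w = cnj (symbol_kernel s n \<psi> \<phi> w z)"
      by (intro hermitian_onD[OF herm]) auto
    moreover have "\<psi> z = z ^ n * \<omega> z" "\<psi> w = w ^ n * \<omega> w"
      using z w \<psi> by auto
    ultimately have "(z * cnj w) ^ n * ?M z w = cnj ((w * cnj z) ^ n * ?M w z)"
      by (simp only: symbol_kernel_power_mult)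
    then have "(z * cnj w) ^ n * ?M z w = (z * cnj w) ^ n * cnj (?M w z)"
      by (simp add: mult.commute)
    then show "?M z w = cnj (?M w z)"
      using z w by simp
  qed
  show "continuous_on (ball 0 1) (\<lambda>z. ?M z w)" if "w \<in> ball 0 1" for w
    by (rule symbol_kernel_continuous_on_left[OF \<phi> \<omega> that])
  show "continuous_on (ball 0 1) (\<lambda>w. ?M z w)" if "z \<in> ball 0 1" for z
    using \<phi>(2) that by (intro symbol_kernel_continuous_on_right) blast
qed auto

lemma hermitian_symbol_kernel_weight:
  assumes herm: "hermitian_on (ball 0 1) (symbol_kernel s 0 \<omega> \<phi>)"
    and "\<phi> 0 \<in> ball 0 1"
  shows "\<omega> 0 \<in> \<real>"
    and "z \<in> ball 0 1 \<Longrightarrow> \<omega> z = \<omega> 0 / kernel_denom s (\<phi> 0) z"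
proof -
  have eq: "\<omega> z = cnj (\<omega> 0) / kernel_denom s (\<phi> 0) z" if "z \<in> ball 0 1" for z
    using hermitian_onD[OF herm that, of 0] cnj_kernel_denom[OF that assms(2)]
    by (simp add: symbol_kernel_def)
  show "\<omega> 0 \<in> \<real>"
    using eq[of 0] by (simp add: Reals_cnj_iff)
  then show "\<omega> z = \<omega> 0 / kernel_denom s (\<phi> 0) z" if "z \<in> ball 0 1"
    using eq[OF that] by (simp add: Reals_cnj_iff)
qed

lemma hermitian_symbol_kernel_denom_eq:
  assumes herm: "hermitian_on (ball 0 1) (symbol_kernel s 0 \<omega> \<phi>)"
    and maps: "\<phi> ` ball 0 1 \<subseteq> ball 0 1" and nonzero: "\<omega> 0 \<noteq> 0"
    and z: "z \<in> ball 0 1" and w: "w \<in> ball 0 1"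
  shows "kernel_denom s w (\<phi> 0) * kernel_denom s (\<phi> w) z
    = kernel_denom s (\<phi> 0) z * kernel_denom s w (\<phi> z)"
proof -
  have in_ball: "\<phi> 0 \<in> ball 0 1" "\<phi> z \<in> ball 0 1" "\<phi> w \<in> ball 0 1"
    using maps z w by (auto simp: image_subset_iff)
  note \<omega> = hermitian_symbol_kernel_weight[OF herm in_ball(1)]
  have "\<omega> z / kernel_denom s w (\<phi> z) = cnj (\<omega> w) / kernel_denom s (\<phi> w) z"
    using hermitian_onD[OF herm z w] cnj_kernel_denom[OF z in_ball(3)]
    by (simp add: symbol_kernel_def)
  moreover have "\<omega> z = \<omega> 0 / kernel_denom s (\<phi> 0) z" "cnj (\<omega> w) = \<omega> 0 / kernel_denom s w (\<phi> 0)"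
    using \<omega>(1) cnj_kernel_denom[OF in_ball(1) w]
    by (simp_all add: \<omega>(2)[OF z] \<omega>(2)[OF w] Reals_cnj_iff)
  ultimately show ?thesis
    using nonzero by (simp add: field_simps kernel_denom_nonzero z w in_ball)
qed

lemma hermitian_symbol_kernel_map:
  assumes herm: "hermitian_on (ball 0 1) (symbol_kernel s 0 \<omega> \<phi>)"
    and \<phi>: "\<phi> holomorphic_on ball 0 1" "\<phi> ` ball 0 1 \<subseteq> ball 0 1"
    and nonzero: "\<omega> 0 \<noteq> 0" "s \<noteq> 0" and w: "w \<in> ball 0 1"
  shows "\<phi> w = moebius_symbol (\<phi> 0) (cnj (deriv \<phi> 0)) w"
proof -
  have in_ball: "\<phi> 0 \<in> ball 0 1" "\<phi> w \<in> ball 0 1"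
    using \<phi>(2) w by (auto simp: image_subset_iff)
  let ?D = "kernel_denom s w (\<phi> 0)"
  have "((\<lambda>z. ?D * kernel_denom s (\<phi> w) z) has_field_derivative
      - of_real s * cnj (\<phi> w) * ?D) (at 0)"
    by (rule derivative_eq_intros kernel_denom_has_field_derivative in_ball(2) | simp)+
  then have "((\<lambda>z. kernel_denom s (\<phi> 0) z * kernel_denom s w (\<phi> z))
      has_field_derivative - of_real s * cnj (\<phi> w) * ?D) (at 0)"
    by (rule has_field_derivative_transform_within_open[of _ _ _ "ball 0 1"])
      (auto simp: hermitian_symbol_kernel_denom_eq[OF herm \<phi>(2) nonzero(1) _ w])
  moreover have "((\<lambda>z. kernel_denom s (\<phi> 0) z * kernel_denom s w (\<phi> z)) has_field_derivative
      - of_real s * (cnj (\<phi> 0) + cnj w * deriv \<phi> 0 / (1 - cnj w * \<phi> 0)) * ?D) (at 0)"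
    by (rule derivative_eq_intros kernel_denom_has_field_derivative
          holomorphic_derivI[OF \<phi>(1)] in_ball(1) w
        | simp add: algebra_simps)+
  ultimately have "cnj (\<phi> w) = cnj (\<phi> 0) + cnj w * deriv \<phi> 0 / (1 - cnj w * \<phi> 0)"
    using DERIV_unique nonzero(2) kernel_denom_nonzero[OF w in_ball(1)] by fastforce
  from arg_cong[OF this, of cnj] show ?thesis
    by (simp add: moebius_symbol_def mult.commute)
qed

lemma moebius_symbol_has_field_derivative_0:
  "(moebius_symbol c b has_field_derivative b) (at 0)"
  unfolding moebius_symbol_def[abs_def] by (auto intro!: derivative_eq_intros)

lemma one_minus_cnj_mult_moebius_symbol:
  assumes "c \<in> ball 0 1" "z \<in> ball 0 1" "w \<in> ball 0 1" and "b \<in> \<real>"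
  shows "(1 - cnj c * z) * (1 - cnj w * moebius_symbol c b z)
    = (1 - cnj w * c) * (1 - cnj (moebius_symbol c b w) * z)"
proof -
  have "(moebius_symbol c b z - c) * (1 - cnj c * z) = b * z"
    using one_minus_cnj_mult_nonzero[OF assms(1,2)] by (simp add: moebius_symbol_def)
  moreover have "(cnj (moebius_symbol c b w) - cnj c) * (1 - cnj w * c) = b * cnj w"
    using one_minus_cnj_mult_nonzero[OF assms(3,1)] \<open>b \<in> \<real>\<close>
    by (simp add: moebius_symbol_def Reals_cnj_iff mult.commute)
  ultimately show ?thesis by algebra
qed

lemma powr_mult_Re_pos:
  assumes "Re x > 0" "Re y > 0"
  shows "(x * y) powr s = x powr s * y powr (s :: complex)"
proof -
  have nonzero: "x \<noteq> 0" "y \<noteq> 0" using assms by auto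
  have "Ln (x * y) = Ln x + Ln y"
    using Re_Ln_pos_lt_imp[OF assms(1)] Re_Ln_pos_lt_imp[OF assms(2)] nonzero
    by (intro Ln_times_simple) auto
  then show ?thesis using nonzero by (simp add: powr_def ring_distribs exp_add)
qed

lemma hermitian_weight_moebius_symbol:
  assumes c_in_ball: "c \<in> ball 0 1" and real: "L \<in> \<real>" "b \<in> \<real>"
    and maps: "moebius_symbol c b ` ball 0 1 \<subseteq> ball 0 1"
  shows "hermitian_on (ball 0 1) (symbol_kernel s n (weight_symbol s n L c) (moebius_symbol c b))"
  unfolding hermitian_on_def
proof (intro ballI)
  fix z w :: complex assume z: "z \<in> ball 0 1" and w: "w \<in> ball 0 1"
  let ?\<phi> = "moebius_symbol c b"
  have in_ball: "?\<phi> z \<in> ball 0 1" "?\<phi> w \<in> ball 0 1"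
    using maps z w by (auto simp: image_subset_iff)
  have "kernel_denom s c z * kernel_denom s w (?\<phi> z) = kernel_denom s w c * kernel_denom s (?\<phi> w) z"
    using one_minus_cnj_mult_moebius_symbol[OF c_in_ball z w real(2)] c_in_ball z w in_ball
    unfolding kernel_denom_def by (metis powr_mult_Re_pos Re_one_minus_cnj_mult_pos)
  then show "symbol_kernel s n (weight_symbol s n L c) ?\<phi> z w
      = cnj (symbol_kernel s n (weight_symbol s n L c) ?\<phi> w z)"
    using real(1) c_in_ball z w in_ball
    by (simp add: symbol_kernel_def weight_symbol_def cnj_kernel_denom Reals_cnj_iff mult_ac)
qed

lemma hermitian_symbol_kernel_cong:
  assumes "\<And>z. z \<in> S \<Longrightarrow> \<psi> z = \<psi>' z" "\<And>z. z \<in> S \<Longrightarrow> \<phi> z = \<phi>' z"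
  shows "hermitian_on S (symbol_kernel s n \<psi> \<phi>) \<longleftrightarrow> hermitian_on S (symbol_kernel s n \<psi>' \<phi>')"
  using assms by (simp add: hermitian_on_def symbol_kernel_def)

lemma symbols_eq_if_hermitian_symbol_kernel:
  assumes herm: "hermitian_on (ball 0 1) (symbol_kernel s n \<psi> \<phi>)"
    and \<phi>: "\<phi> holomorphic_on ball 0 1" "\<phi> ` ball 0 1 \<subseteq> ball 0 1"
    and nonzero: "s \<noteq> 0" "\<exists>z\<in>ball 0 1. \<psi> z \<noteq> 0"
  shows "taylor_coeff \<psi> n \<in> \<real>" and "deriv \<phi> 0 \<in> \<real>"
    and "\<And>z. z \<in> ball 0 1 \<Longrightarrow> \<psi> z = weight_symbol s n (taylor_coeff \<psi> n) (\<phi> 0) z"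
    and "\<And>z. z \<in> ball 0 1 \<Longrightarrow> \<phi> z = moebius_symbol (\<phi> 0) (deriv \<phi> 0) z"
proof -
  have \<phi>0_in_ball: "\<phi> 0 \<in> ball 0 1" using \<phi>(2) by (auto simp: image_subset_iff)
  obtain \<omega> where \<omega>: "\<omega> holomorphic_on ball 0 1" and \<psi>: "\<And>z. z \<in> ball 0 1 \<Longrightarrow> \<psi> z = z ^ n * \<omega> z"
    by (rule hermitian_symbol_kernel_factor[OF herm \<phi>]) blast
  have herm_\<omega>: "hermitian_on (ball 0 1) (symbol_kernel s 0 \<omega> \<phi>)"
    by (rule hermitian_symbol_kernel_cancel_power[OF herm \<phi> \<omega> \<psi>])
  note \<omega>_eq = hermitian_symbol_kernel_weight[OF herm_\<omega> \<phi>0_in_ball]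
  have \<omega>_0: "\<omega> 0 = taylor_coeff \<psi> n"
    using taylor_coeff_power_mult[OF \<omega> zero_less_one \<psi>] by simp
  show "taylor_coeff \<psi> n \<in> \<real>"
    using \<omega>_eq(1) unfolding \<omega>_0 .
  show \<psi>_eq: "\<psi> z = weight_symbol s n (taylor_coeff \<psi> n) (\<phi> 0) z" if "z \<in> ball 0 1" for z
    using \<psi>[OF that] \<omega>_eq(2)[of z] that by (simp add: weight_symbol_def \<omega>_0 mult.commute)
  then have "\<omega> 0 \<noteq> 0"
    using nonzero(2) by (auto simp: weight_symbol_def \<omega>_0)
  note \<phi>_eq = hermitian_symbol_kernel_map[OF herm_\<omega> \<phi> this nonzero(1)]
  from has_field_derivative_transform_within_open
    [OF moebius_symbol_has_field_derivative_0 open_ball[of 0 1] _ \<phi>_eq[symmetric]]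
  have "(\<phi> has_field_derivative cnj (deriv \<phi> 0)) (at 0)"
    by simp
  then have real: "cnj (deriv \<phi> 0) = deriv \<phi> 0"
    by (rule DERIV_imp_deriv[symmetric])
  then show "deriv \<phi> 0 \<in> \<real>"
    by (simp add: Reals_cnj_iff)
  show "\<phi> z = moebius_symbol (\<phi> 0) (deriv \<phi> 0) z" if "z \<in> ball 0 1" for z
    using \<phi>_eq[OF that] unfolding real .
qed

lemma hermitian_symbol_kernel_iff:
  assumes nonzero: "s \<noteq> 0" "\<exists>z\<in>ball 0 1. \<psi> z \<noteq> 0"
    and \<phi>: "\<phi> holomorphic_on ball 0 1" "\<phi> ` ball 0 1 \<subseteq> ball 0 1"
  shows "hermitian_on (ball 0 1) (symbol_kernel s n \<psi> \<phi>) \<longleftrightarrow>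
    (\<forall>z\<in>ball 0 1. \<psi> z = weight_symbol s n (taylor_coeff \<psi> n) (\<phi> 0) z \<and>
      \<phi> z = moebius_symbol (\<phi> 0) (deriv \<phi> 0) z) \<and>
    taylor_coeff \<psi> n \<in> \<real> \<and> deriv \<phi> 0 \<in> \<real>" (is "?herm \<longleftrightarrow> ?form")
proof
  show ?form if ?herm
    using symbols_eq_if_hermitian_symbol_kernel[OF that \<phi> nonzero] by blast
next
  let ?\<psi> = "weight_symbol s n (taylor_coeff \<psi> n) (\<phi> 0)" and ?\<phi> = "moebius_symbol (\<phi> 0) (deriv \<phi> 0)"
  assume form: ?form
  then have eq: "\<psi> z = ?\<psi> z" "\<phi> z = ?\<phi> z" if "z \<in> ball 0 1" for z
    using that by blast+
  have "?\<phi> ` ball 0 1 = \<phi> ` ball 0 1"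
    by (rule image_cong[OF refl]) (rule eq(2)[symmetric])
  then have "?\<phi> ` ball 0 1 \<subseteq> ball 0 1"
    using \<phi>(2) by simp
  moreover have "\<phi> 0 \<in> ball 0 1"
    using \<phi>(2) by (auto simp: image_subset_iff)
  ultimately have "hermitian_on (ball 0 1) (symbol_kernel s n ?\<psi> ?\<phi>)"
    using form by (intro hermitian_weight_moebius_symbol) blast+
  moreover have "?herm \<longleftrightarrow> hermitian_on (ball 0 1) (symbol_kernel s n ?\<psi> ?\<phi>)"
    by (intro hermitian_symbol_kernel_cong eq)
  ultimately show ?herm by simp
qed

section \<open>Weighted square-summable sequences\<close>

lemma summable_weighted_squares_add:
  fixes x y :: "nat \<Rightarrow> 'a :: real_normed_vector"
  assumes w: "\<And>j. 0 \<le> w j"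
    and x: "summable (\<lambda>j. (norm (x j))\<^sup>2 * w j)" and y: "summable (\<lambda>j. (norm (y j))\<^sup>2 * w j)"
  shows "summable (\<lambda>j. (norm (x j + y j))\<^sup>2 * w j)"
proof (rule summable_comparison_test')
  show "summable (\<lambda>j. 2 * ((norm (x j))\<^sup>2 * w j) + 2 * ((norm (y j))\<^sup>2 * w j))"
    by (intro summable_add summable_mult x y)
  fix j :: nat
  have "(norm (x j + y j))\<^sup>2 \<le> (norm (x j) + norm (y j))\<^sup>2"
    by (intro power_mono norm_triangle_ineq) auto
  also have "\<dots> \<le> 2 * (norm (x j))\<^sup>2 + 2 * (norm (y j))\<^sup>2"
    using zero_le_power2[of "norm (x j) - norm (y j)"] by (simp add: power2_sum power2_diff)
  finally have "(norm (x j + y j))\<^sup>2 * w j \<le> (2 * (norm (x j))\<^sup>2 + 2 * (norm (y j))\<^sup>2) * w j"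
    by (intro mult_right_mono w)
  then show "norm ((norm (x j + y j))\<^sup>2 * w j)
      \<le> 2 * ((norm (x j))\<^sup>2 * w j) + 2 * ((norm (y j))\<^sup>2 * w j)"
    using w[of j] by (simp add: algebra_simps)
qed

lemma weighted_Cauchy_Schwarz:
  fixes x y w :: "nat \<Rightarrow> real"
  assumes w: "\<And>j. 0 \<le> w j"
    and x: "summable (\<lambda>j. (x j)\<^sup>2 * w j)" and y: "summable (\<lambda>j. (y j)\<^sup>2 * w j)"
  shows "summable (\<lambda>j. \<bar>x j * y j\<bar> * w j)" (is ?summable)
    and "(\<Sum>j. \<bar>x j * y j\<bar> * w j) \<le> sqrt (\<Sum>j. (x j)\<^sup>2 * w j) * sqrt (\<Sum>j. (y j)\<^sup>2 * w j)"
      (is "_ \<le> ?bound")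
proof -
  have L2_le: "L2_set (\<lambda>j. u j * sqrt (w j)) {..<N} \<le> sqrt (\<Sum>j. (u j)\<^sup>2 * w j)"
    if "summable (\<lambda>j. (u j)\<^sup>2 * w j)" for u :: "nat \<Rightarrow> real" and N
    using that w by (auto simp: L2_set_def power_mult_distrib intro!: sum_le_suminf)
  have partial: "(\<Sum>j<N. \<bar>x j * y j\<bar> * w j) \<le> ?bound" for N
  proof -
    have "\<bar>x j * y j\<bar> * w j = \<bar>x j * sqrt (w j)\<bar> * \<bar>y j * sqrt (w j)\<bar>" for j
      using w[of j] by (simp add: abs_mult mult_ac flip: real_sqrt_mult)
    then have "(\<Sum>j<N. \<bar>x j * y j\<bar> * w j)
        \<le> L2_set (\<lambda>j. x j * sqrt (w j)) {..<N} * L2_set (\<lambda>j. y j * sqrt (w j)) {..<N}"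
      by (simp only: L2_set_mult_ineq)
    also have "\<dots> \<le> ?bound"
      using w by (intro mult_mono L2_le x y L2_set_nonneg real_sqrt_ge_zero suminf_nonneg) auto
    finally show ?thesis .
  qed
  show ?summable
    by (rule summableI_nonneg_bounded[OF _ partial]) (simp add: w)
  then show "(\<Sum>j. \<bar>x j * y j\<bar> * w j) \<le> ?bound"
    by (rule suminf_le_const[OF _ partial])
qed

section \<open>Weighted Bergman spaces\<close>

lemma bergman_space_holomorphic: "f \<in> bergman_space \<alpha> \<Longrightarrow> f holomorphic_on ball 0 1"
  by (simp add: bergman_space_def)

lemma bergman_space_analytic_0: "f \<in> bergman_space \<alpha> \<Longrightarrow> f analytic_on {0}"
  by (rule holomorphic_on_imp_analytic_at[of _ "ball 0 1"]) (auto simp: bergman_space_holomorphic)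

lemma bergman_space_outside: "f \<in> bergman_space \<alpha> \<Longrightarrow> z \<notin> ball 0 1 \<Longrightarrow> f z = 0"
  by (simp add: bergman_space_def)

lemma bergman_space_summable:
  "f \<in> bergman_space \<alpha> \<Longrightarrow> summable (\<lambda>j. (cmod (taylor_coeff f j))\<^sup>2 * bergman_weight \<alpha> j)"
  by (simp add: bergman_space_def)

lemma bergman_space_eqI:
  assumes "f \<in> bergman_space \<alpha>" "g \<in> bergman_space \<alpha>" "\<And>j. taylor_coeff f j = taylor_coeff g j"
  shows "f = g"
proof
  fix z
  show "f z = g z"
  proof (cases "z \<in> ball 0 1")
    case True
    then have "(\<lambda>j. taylor_coeff f j * z ^ j) sums f z" "(\<lambda>j. taylor_coeff g j * z ^ j) sums g z"
      using assms(1,2) by (auto intro!: taylor_coeff_sums simp: bergman_space_holomorphic)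
    then show ?thesis
      unfolding assms(3) by (rule sums_unique2)
  next
    case False
    then show ?thesis
      using assms(1,2) by (simp add: bergman_space_outside)
  qed
qed

lemma bounded_operator_in_space:
  "bounded_operator \<alpha> T \<Longrightarrow> f \<in> bergman_space \<alpha> \<Longrightarrow> T f \<in> bergman_space \<alpha>"
  by (simp add: bounded_operator_def)

definition monomial :: "nat \<Rightarrow> complex \<Rightarrow> complex" where
  "monomial j z = (if z \<in> ball 0 1 then z ^ j else 0)"

lemma taylor_coeff_monomial: "taylor_coeff (monomial j) i = (if i = j then 1 else 0)"
proof (rule taylor_coeff_eqI[OF zero_less_one])
  fix z :: complex assume "z \<in> ball 0 1"
  then show "(\<lambda>i. (if i = j then 1 else 0) * z ^ i) sums monomial j z"
    using sums_single[of j "\<lambda>i. z ^ i"]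
    by (simp add: monomial_def if_distrib[of "\<lambda>x. x * _"] cong: if_cong)
qed

lemma monomial_in_space: "monomial j \<in> bergman_space \<alpha>"
proof -
  have "monomial j holomorphic_on ball 0 1 \<longleftrightarrow> (\<lambda>z. z ^ j) holomorphic_on ball 0 1"
    by (rule holomorphic_cong) (auto simp: monomial_def)
  moreover have "summable (\<lambda>i. (cmod (taylor_coeff (monomial j) i))\<^sup>2 * bergman_weight \<alpha> i)"
    by (rule summable_finite[of "{j}"]) (auto simp: taylor_coeff_monomial)
  ultimately show ?thesis
    by (auto simp: bergman_space_def monomial_def intro!: holomorphic_intros)
qed

lemma bergman_inner_monomial_left:
  "bergman_inner \<alpha> (monomial j) f = cnj (taylor_coeff f j) * of_real (bergman_weight \<alpha> j)"
  unfolding bergman_inner_def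
  by (subst suminf_finite[of "{j}"]) (auto simp: taylor_coeff_monomial)

primrec taylor_tail :: "(complex \<Rightarrow> complex) \<Rightarrow> nat \<Rightarrow> complex \<Rightarrow> complex" where
  "taylor_tail f 0 = f"
| "taylor_tail f (Suc N) = (\<lambda>z. taylor_tail f N z - taylor_coeff f N * monomial N z)"

lemma taylor_tail_Suc_lincomb:
  "taylor_tail f (Suc N) = (\<lambda>z. 1 * taylor_tail f N z + (- taylor_coeff f N) * monomial N z)"
  by simp

lemma binomial_series_neg:
  fixes u :: complex and s :: real
  assumes "cmod u < 1"
  shows "(\<lambda>i. of_real (pochhammer s i / fact i) * u ^ i) sums inverse ((1 - u) powr of_real s)"
proof -
  have "(\<lambda>i. ((- of_real s) gchoose i) * (- u) ^ i) sums (1 + (- u)) powr (- of_real s)"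
    using assms by (intro gen_binomial_complex) simp
  moreover have "((- complex_of_real s) gchoose i) * (- u) ^ i
      = of_real (pochhammer s i / fact i) * u ^ i" for i
  proof -
    have "((- complex_of_real s) gchoose i) * (- u) ^ i
        = ((-1) ^ i * (-1) ^ i) * (pochhammer (of_real s) i / fact i * u ^ i)"
      unfolding gbinomial_pochhammer power_minus[of u] by simp
    also have "(-1) ^ i * (-1) ^ i = (1 :: complex)" by (simp flip: power_mult_distrib)
    finally show ?thesis by (simp flip: pochhammer_of_real)
  qed
  ultimately show ?thesis by (simp add: powr_minus)
qed

locale weighted_bergman =
  fixes \<alpha> :: real
  assumes alpha: "\<alpha> > -1"
begin

abbreviation inner_product ("\<langle>_, _\<rangle>") where
  "\<langle>f, g\<rangle> \<equiv> bergman_inner \<alpha> f g"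

lemma pochhammer_alpha_pos: "pochhammer (\<alpha> + 2) j > 0"
  using alpha by (intro pochhammer_pos) simp

lemma bergman_weight_eq: "bergman_weight \<alpha> j = fact j / pochhammer (\<alpha> + 2) j"
proof -
  have "\<alpha> + 2 \<notin> \<int>\<^sub>\<le>\<^sub>0" using alpha by (auto elim!: nonpos_Ints_cases)
  from pochhammer_Gamma[OF this, of j] show ?thesis
    by (simp add: bergman_weight_def add_ac)
qed

lemma bergman_weight_pos: "bergman_weight \<alpha> j > 0"
  using pochhammer_alpha_pos[of j] by (simp add: bergman_weight_eq)

lemma bergman_weight_nonneg [simp]: "0 \<le> bergman_weight \<alpha> j"
  and bergman_weight_nonzero [simp]: "bergman_weight \<alpha> j \<noteq> 0"
  using bergman_weight_pos[of j] by simp_all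

lemma lincomb_in_space:
  assumes f: "f \<in> bergman_space \<alpha>" and g: "g \<in> bergman_space \<alpha>"
  shows "(\<lambda>z. p * f z + q * g z) \<in> bergman_space \<alpha>"
proof -
  have "summable (\<lambda>j. (cmod (p * taylor_coeff f j + q * taylor_coeff g j))\<^sup>2 * bergman_weight \<alpha> j)"
    using f g
    by (intro summable_weighted_squares_add bergman_weight_nonneg)
      (simp_all add: norm_mult power_mult_distrib mult.assoc summable_mult bergman_space_summable)
  then show ?thesis
    using f g by (auto simp: bergman_space_def taylor_coeff_lincomb bergman_space_analytic_0
        intro!: holomorphic_intros)
qed

lemma inner_sums:
  assumes "f \<in> bergman_space \<alpha>" "g \<in> bergman_space \<alpha>"
  shows "(\<lambda>j. taylor_coeff f j * cnj (taylor_coeff g j) * of_real (bergman_weight \<alpha> j)) sums \<langle>f, g\<rangle>"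
proof -
  let ?u = "\<lambda>j. taylor_coeff f j * cnj (taylor_coeff g j) * of_real (bergman_weight \<alpha> j)"
  have "summable (\<lambda>j. cmod (?u j))"
    using weighted_Cauchy_Schwarz(1)[OF bergman_weight_nonneg assms[THEN bergman_space_summable]]
    by (simp add: norm_mult)
  then have "summable ?u"
    by (rule summable_norm_cancel)
  then show ?thesis
    by (simp add: bergman_inner_def summable_sums)
qed

lemma bergman_norm_nonneg: "f \<in> bergman_space \<alpha> \<Longrightarrow> 0 \<le> bergman_norm \<alpha> f"
  by (simp add: bergman_norm_def suminf_nonneg bergman_space_summable)

lemma inner_Cauchy_Schwarz:
  assumes "f \<in> bergman_space \<alpha>" "g \<in> bergman_space \<alpha>"
  shows "cmod \<langle>f, g\<rangle> \<le> bergman_norm \<alpha> f * bergman_norm \<alpha> g"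
proof -
  let ?u = "\<lambda>j. \<bar>cmod (taylor_coeff f j) * cmod (taylor_coeff g j)\<bar> * bergman_weight \<alpha> j"
  note Cauchy_Schwarz =
    weighted_Cauchy_Schwarz[OF bergman_weight_nonneg assms[THEN bergman_space_summable]]
  have "cmod \<langle>f, g\<rangle> \<le> (\<Sum>j. ?u j)"
    unfolding bergman_inner_def using Cauchy_Schwarz(1)
    by (intro norm_suminf_le) (simp_all add: norm_mult)
  also have "\<dots> \<le> bergman_norm \<alpha> f * bergman_norm \<alpha> g"
    unfolding bergman_norm_def by (rule Cauchy_Schwarz(2))
  finally show ?thesis .
qed

lemma inner_commute:
  assumes "f \<in> bergman_space \<alpha>" "g \<in> bergman_space \<alpha>"
  shows "\<langle>g, f\<rangle> = cnj \<langle>f, g\<rangle>"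
proof -
  have "(\<lambda>j. taylor_coeff g j * cnj (taylor_coeff f j) * of_real (bergman_weight \<alpha> j))
      sums cnj \<langle>f, g\<rangle>"
    using sums_cnj[THEN iffD2, OF inner_sums[OF assms]] by (simp add: mult_ac)
  with inner_sums[OF assms(2,1)] show ?thesis
    by (rule sums_unique2)
qed

lemma inner_lincomb_right:
  assumes f: "f \<in> bergman_space \<alpha>" and g: "g \<in> bergman_space \<alpha>" and h: "h \<in> bergman_space \<alpha>"
  shows "\<langle>f, \<lambda>z. p * g z + q * h z\<rangle> = cnj p * \<langle>f, g\<rangle> + cnj q * \<langle>f, h\<rangle>"
proof -
  let ?u = "\<lambda>k j. taylor_coeff f j * cnj (taylor_coeff k j) * of_real (bergman_weight \<alpha> j)"
  have "(\<lambda>j. cnj p * ?u g j + cnj q * ?u h j) sums (cnj p * \<langle>f, g\<rangle> + cnj q * \<langle>f, h\<rangle>)"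
    using assms by (intro sums_add sums_mult inner_sums)
  moreover have "cnj p * ?u g j + cnj q * ?u h j = ?u (\<lambda>z. p * g z + q * h z) j" for j
    using g h by (simp add: taylor_coeff_lincomb bergman_space_analytic_0 algebra_simps)
  ultimately have "?u (\<lambda>z. p * g z + q * h z) sums (cnj p * \<langle>f, g\<rangle> + cnj q * \<langle>f, h\<rangle>)"
    by simp
  with inner_sums[OF f lincomb_in_space[OF g h]] show ?thesis
    by (rule sums_unique2)
qed

lemma taylor_tail_in_space:
  assumes "f \<in> bergman_space \<alpha>"
  shows "taylor_tail f N \<in> bergman_space \<alpha>"
proof (induction N)
  case (Suc N)
  then show ?case
    unfolding taylor_tail_Suc_lincomb by (intro lincomb_in_space monomial_in_space)
qed (simp add: assms)

lemma taylor_coeff_taylor_tail: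
  assumes "f \<in> bergman_space \<alpha>"
  shows "taylor_coeff (taylor_tail f N) j = (if j < N then 0 else taylor_coeff f j)"
proof (induction N)
  case (Suc N)
  then show ?case
    unfolding taylor_tail_Suc_lincomb
    by (subst taylor_coeff_lincomb)
      (auto simp: taylor_coeff_monomial less_Suc_eq
        intro!: bergman_space_analytic_0 taylor_tail_in_space monomial_in_space assms)
qed simp

lemma bergman_norm_taylor_tail_tendsto_0:
  assumes f: "f \<in> bergman_space \<alpha>"
  shows "(\<lambda>N. bergman_norm \<alpha> (taylor_tail f N)) \<longlonglongrightarrow> 0"
proof -
  let ?u = "\<lambda>g j. (cmod (taylor_coeff g j))\<^sup>2 * bergman_weight \<alpha> j"
  have "(\<Sum>j. ?u (taylor_tail f N) j) = (\<Sum>j. ?u f (j + N))" for N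
    using suminf_split_initial_segment
      [OF bergman_space_summable[OF taylor_tail_in_space[OF f]], of N N]
    by (simp add: taylor_coeff_taylor_tail[OF f])
  then have "bergman_norm \<alpha> (taylor_tail f N) = sqrt (\<Sum>j. ?u f (j + N))" for N
    by (simp add: bergman_norm_def)
  moreover have "(\<lambda>N. sqrt (\<Sum>j. ?u f (j + N))) \<longlonglongrightarrow> sqrt 0"
    by (intro tendsto_real_sqrt suminf_exist_split2 bergman_space_summable f)
  ultimately show ?thesis by simp
qed

section \<open>Bounded operators and reproducing kernels\<close>

lemma inner_bounded_operator_lincomb:
  assumes T: "bounded_operator \<alpha> T" and f: "f \<in> bergman_space \<alpha>"
    and g: "g \<in> bergman_space \<alpha>" and h: "h \<in> bergman_space \<alpha>"
  shows "\<langle>f, T (\<lambda>z. p * g z + q * h z)\<rangle> = cnj p * \<langle>f, T g\<rangle> + cnj q * \<langle>f, T h\<rangle>"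
proof -
  have "T (\<lambda>z. p * g z + q * h z) = (\<lambda>z. p * T g z + q * T h z)"
    using T g h by (auto simp: bounded_operator_def)
  then show ?thesis
    using inner_lincomb_right[OF f] bounded_operator_in_space[OF T] g h by simp
qed

lemma inner_bounded_operator_sums:
  assumes T: "bounded_operator \<alpha> T" and f: "f \<in> bergman_space \<alpha>" and g: "g \<in> bergman_space \<alpha>"
  shows "(\<lambda>j. cnj (taylor_coeff g j) * \<langle>f, T (monomial j)\<rangle>) sums \<langle>f, T g\<rangle>"
proof -
  let ?S = "\<lambda>N. \<Sum>j<N. cnj (taylor_coeff g j) * \<langle>f, T (monomial j)\<rangle>"
  note tail = taylor_tail_in_space[OF g]
  have remainder: "\<langle>f, T (taylor_tail g N)\<rangle> = \<langle>f, T g\<rangle> - ?S N" for N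
  proof (induction N)
    case (Suc N)
    then show ?case
      unfolding taylor_tail_Suc_lincomb
        inner_bounded_operator_lincomb[OF T f tail monomial_in_space]
      by simp
  qed simp
  obtain M where M: "bergman_norm \<alpha> (T h) \<le> M * bergman_norm \<alpha> h" if "h \<in> bergman_space \<alpha>" for h
    using T unfolding bounded_operator_def by metis
  have bound: "cmod \<langle>f, T (taylor_tail g N)\<rangle>
      \<le> bergman_norm \<alpha> f * (M * bergman_norm \<alpha> (taylor_tail g N))" for N
    using inner_Cauchy_Schwarz[OF f bounded_operator_in_space[OF T tail]]
      mult_left_mono[OF M[OF tail] bergman_norm_nonneg[OF f]] by (rule order.trans)
  have "(\<lambda>N. bergman_norm \<alpha> f * (M * bergman_norm \<alpha> (taylor_tail g N))) \<longlonglongrightarrow> 0"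
    by (intro tendsto_mult_right_zero bergman_norm_taylor_tail_tendsto_0 g)
  then have "(\<lambda>N. \<langle>f, T (taylor_tail g N)\<rangle>) \<longlonglongrightarrow> 0"
    by (rule Lim_null_comparison[rotated]) (use bound in auto)
  then have "(\<lambda>N. \<langle>f, T g\<rangle> - \<langle>f, T (taylor_tail g N)\<rangle>) \<longlonglongrightarrow> \<langle>f, T g\<rangle> - 0"
    by (intro tendsto_diff tendsto_const)
  then show ?thesis
    by (simp add: remainder sums_def)
qed

definition reproducing_kernel :: "complex \<Rightarrow> nat \<Rightarrow> complex \<Rightarrow> complex" where
  "reproducing_kernel w m z = (if z \<in> ball 0 1 then
     of_real (pochhammer (\<alpha> + 2) m) * z ^ m / kernel_denom (real m + \<alpha> + 2) w z else 0)"

definition reproducing_kernel_coeff :: "complex \<Rightarrow> nat \<Rightarrow> nat \<Rightarrow> complex" where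
  "reproducing_kernel_coeff w m j = (if j < m then 0 else
     of_real (pochhammer (\<alpha> + 2) j / fact (j - m)) * cnj w ^ (j - m))"

lemma reproducing_kernel_sums:
  assumes w: "w \<in> ball 0 1" and z: "z \<in> ball 0 1"
  shows "(\<lambda>j. reproducing_kernel_coeff w m j * z ^ j) sums reproducing_kernel w m z"
proof -
  let ?s = "real m + \<alpha> + 2" and ?p = "complex_of_real (pochhammer (\<alpha> + 2) m)"
  have "(\<lambda>i. ?p * z ^ m * (of_real (pochhammer ?s i / fact i) * (cnj w * z) ^ i))
      sums (?p * z ^ m * inverse (kernel_denom ?s w z))"
    unfolding kernel_denom_def by (intro sums_mult binomial_series_neg norm_cnj_mult_less_1 w z)
  moreover have "?p * z ^ m * (of_real (pochhammer ?s i / fact i) * (cnj w * z) ^ i)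
      = reproducing_kernel_coeff w m (i + m) * z ^ (i + m)" for i
    using pochhammer_product'[of "\<alpha> + 2" m i]
    by (simp add: reproducing_kernel_coeff_def power_add power_mult_distrib add_ac)
  ultimately have "(\<lambda>i. reproducing_kernel_coeff w m (i + m) * z ^ (i + m))
      sums reproducing_kernel w m z"
    using z by (simp add: reproducing_kernel_def field_simps)
  then show ?thesis
    by (subst (asm) sums_zero_iff_shift) (auto simp: reproducing_kernel_coeff_def)
qed

lemma taylor_coeff_reproducing_kernel:
  assumes "w \<in> ball 0 1"
  shows "taylor_coeff (reproducing_kernel w m) j = reproducing_kernel_coeff w m j"
  by (intro taylor_coeff_eqI[OF zero_less_one] reproducing_kernel_sums assms)

lemma reproducing_kernel_holomorphic:
  "w \<in> ball 0 1 \<Longrightarrow> reproducing_kernel w m holomorphic_on ball 0 1"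
  by (rule power_series_holomorphic[of 0 1 "reproducing_kernel_coeff w m"])
    (simp add: reproducing_kernel_sums)

text \<open>The squared norm of the kernel at \<open>w\<close> depends on \<open>r = \<bar>w\<bar>\<close> only: it is the \<open>m\<close>-th derivative
  at \<open>r\<close> of the kernel at \<open>r\<close>, hence finite.\<close>

lemma reproducing_kernel_in_space:
  assumes w: "w \<in> ball 0 1"
  shows "reproducing_kernel w m \<in> bergman_space \<alpha>"
proof -
  define r where "r = complex_of_real (cmod w)"
  have r: "r \<in> ball 0 1" using w by (simp add: r_def)
  let ?u = "\<lambda>j. (cmod (reproducing_kernel_coeff w m j))\<^sup>2 * bergman_weight \<alpha> j"
  have "summable (\<lambda>i. reproducing_kernel_coeff r m (i + m) * (fact (i + m) / fact i) * r ^ i)"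
    using higher_deriv_taylor_sums[OF reproducing_kernel_holomorphic[OF r] r, THEN sums_summable]
    by (simp add: taylor_coeff_reproducing_kernel[OF r])
  moreover have "reproducing_kernel_coeff r m (i + m) * (fact (i + m) / fact i) * r ^ i
      = of_real (?u (i + m))" for i
    using pochhammer_alpha_pos[of "i + m"]
    by (simp add: reproducing_kernel_coeff_def r_def bergman_weight_eq norm_mult norm_power
        norm_divide power2_eq_square)
  ultimately have "summable (\<lambda>i. complex_of_real (?u (i + m)))" by simp
  then have "summable (\<lambda>i. ?u (i + m))" by (simp only: summable_of_real_iff)
  then have "summable ?u" by (subst (asm) summable_iff_shift)
  then show ?thesis
    using reproducing_kernel_holomorphic[OF w]
    by (auto simp: bergman_space_def taylor_coeff_reproducing_kernel[OF w] reproducing_kernel_def)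
qed

lemma inner_reproducing_kernel:
  assumes w: "w \<in> ball 0 1" and f: "f \<in> bergman_space \<alpha>"
  shows "\<langle>f, reproducing_kernel w m\<rangle> = (deriv ^^ m) f w"
proof -
  let ?u = "\<lambda>j. taylor_coeff f j * cnj (reproducing_kernel_coeff w m j)
    * of_real (bergman_weight \<alpha> j)"
  have "taylor_coeff f (i + m) * (fact (i + m) / fact i) * w ^ i = ?u (i + m)" for i
    using pochhammer_alpha_pos[of "i + m"]
    by (simp add: reproducing_kernel_coeff_def bergman_weight_eq)
  then have "(\<lambda>i. ?u (i + m)) sums (deriv ^^ m) f w"
    using higher_deriv_taylor_sums[OF bergman_space_holomorphic[OF f] w, of m] by simp
  then have "?u sums (deriv ^^ m) f w"
    by (subst (asm) sums_zero_iff_shift) (auto simp: reproducing_kernel_coeff_def)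
  then show ?thesis
    using inner_sums[OF f reproducing_kernel_in_space[OF w], of m]
    unfolding taylor_coeff_reproducing_kernel[OF w] by (rule sums_unique2[symmetric])
qed

lemma inner_reproducing_kernel_0:
  assumes "w \<in> ball 0 1" "f \<in> bergman_space \<alpha>"
  shows "\<langle>f, reproducing_kernel w 0\<rangle> = f w"
  using inner_reproducing_kernel[OF assms, of 0] by simp

lemma bergman_kernel_eq_reproducing_kernel:
  assumes w: "w \<in> ball 0 1"
  shows "bergman_kernel \<alpha> w m = reproducing_kernel w m"
  unfolding bergman_kernel_def
proof (rule the_equality)
  fix K assume K: "K \<in> bergman_space \<alpha> \<and> (\<forall>f\<in>bergman_space \<alpha>. \<langle>f, K\<rangle> = (deriv ^^ m) f w)"
  show "K = reproducing_kernel w m"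
  proof (rule bergman_space_eqI)
    fix j
    have "\<langle>monomial j, K\<rangle> = \<langle>monomial j, reproducing_kernel w m\<rangle>"
      using K inner_reproducing_kernel[OF w] monomial_in_space by simp
    then show "taylor_coeff K j = taylor_coeff (reproducing_kernel w m) j"
      by (simp add: bergman_inner_monomial_left)
  qed (use K reproducing_kernel_in_space[OF w] in auto)
qed (use reproducing_kernel_in_space inner_reproducing_kernel w in auto)

lemma higher_deriv_reproducing_kernel_0:
  assumes w: "w \<in> ball 0 1" and z: "z \<in> ball 0 1"
  shows "(deriv ^^ m) (reproducing_kernel w 0) z = cnj (reproducing_kernel z m w)"
proof -
  note in_space = reproducing_kernel_in_space[OF w, of 0] reproducing_kernel_in_space[OF z, of m]
  have "(deriv ^^ m) (reproducing_kernel w 0) z = \<langle>reproducing_kernel w 0, reproducing_kernel z m\<rangle>"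
    by (simp add: inner_reproducing_kernel[OF z in_space(1)])
  also have "\<dots> = cnj \<langle>reproducing_kernel z m, reproducing_kernel w 0\<rangle>"
    by (rule inner_commute[OF in_space(2,1)])
  finally show ?thesis by (simp add: inner_reproducing_kernel_0[OF w in_space(2)])
qed

text \<open>The values \<open>\<langle>f, T K\<^sub>w\<rangle>\<close> form a power series in \<open>w\<close> with coefficients
  \<open>\<langle>f, T z\<^sup>j\<rangle> / \<beta>(j)\<^sup>2\<close>, and these determine the antilinear functional \<open>g \<mapsto> \<langle>f, T g\<rangle>\<close>.\<close>

lemma inner_eqI_kernels:
  assumes T: "bounded_operator \<alpha> T" and f: "f \<in> bergman_space \<alpha>" and h: "h \<in> bergman_space \<alpha>"
    and eq: "\<And>w. w \<in> ball 0 1 \<Longrightarrow> \<langle>h, reproducing_kernel w 0\<rangle> = \<langle>f, T (reproducing_kernel w 0)\<rangle>"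
    and g: "g \<in> bergman_space \<alpha>"
  shows "\<langle>h, g\<rangle> = \<langle>f, T g\<rangle>"
proof -
  have coeff: "taylor_coeff h j = \<langle>f, T (monomial j)\<rangle> / of_real (bergman_weight \<alpha> j)" for j
  proof (rule taylor_coeff_eqI[OF zero_less_one])
    fix w :: complex assume w: "w \<in> ball 0 1"
    have "cnj (taylor_coeff (reproducing_kernel w 0) j) * \<langle>f, T (monomial j)\<rangle>
        = \<langle>f, T (monomial j)\<rangle> / of_real (bergman_weight \<alpha> j) * w ^ j" for j
      using pochhammer_alpha_pos[of j]
      by (simp add: taylor_coeff_reproducing_kernel[OF w] reproducing_kernel_coeff_def
          bergman_weight_eq)
    moreover have "\<langle>f, T (reproducing_kernel w 0)\<rangle> = h w"
      using eq[OF w] inner_reproducing_kernel_0[OF w h] by simp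
    ultimately show "(\<lambda>j. \<langle>f, T (monomial j)\<rangle> / of_real (bergman_weight \<alpha> j) * w ^ j) sums h w"
      using inner_bounded_operator_sums[OF T f reproducing_kernel_in_space[OF w], of 0] by simp
  qed
  have "(\<lambda>j. cnj (taylor_coeff g j) * \<langle>f, T (monomial j)\<rangle>) sums \<langle>h, g\<rangle>"
    using inner_sums[OF h g] by (simp add: coeff mult_ac)
  then show ?thesis
    using inner_bounded_operator_sums[OF T f g] by (rule sums_unique2)
qed

lemma is_adjointI_kernels:
  assumes T: "bounded_operator \<alpha> T" and S: "bounded_operator \<alpha> S"
    and eq: "\<And>z w. z \<in> ball 0 1 \<Longrightarrow> w \<in> ball 0 1 \<Longrightarrow>
      T (reproducing_kernel z 0) w = cnj (S (reproducing_kernel w 0) z)"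
  shows "is_adjoint \<alpha> T S"
proof -
  let ?K = "\<lambda>w. reproducing_kernel w 0"
  note T_in = bounded_operator_in_space[OF T] and S_in = bounded_operator_in_space[OF S]
  note K_in = reproducing_kernel_in_space[where m = 0]
  have kernel_left: "\<langle>T (?K z), g\<rangle> = \<langle>?K z, S g\<rangle>"
    if z: "z \<in> ball 0 1" and g: "g \<in> bergman_space \<alpha>" for z g
  proof (rule inner_eqI_kernels[OF S K_in[OF z] T_in[OF K_in[OF z]] _ g])
    fix w :: complex assume w: "w \<in> ball 0 1"
    have "\<langle>T (?K z), ?K w\<rangle> = cnj \<langle>S (?K w), ?K z\<rangle>"
      using eq[OF z w] by (simp only: inner_reproducing_kernel_0 T_in S_in K_in z w)
    then show "\<langle>T (?K z), ?K w\<rangle> = \<langle>?K z, S (?K w)\<rangle>"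
      by (simp add: inner_commute[OF S_in[OF K_in[OF w]] K_in[OF z]])
  qed
  have "\<langle>T f, g\<rangle> = \<langle>f, S g\<rangle>" if f: "f \<in> bergman_space \<alpha>" and g: "g \<in> bergman_space \<alpha>" for f g
  proof -
    have "\<langle>S g, f\<rangle> = \<langle>g, T f\<rangle>"
    proof (rule inner_eqI_kernels[OF T g S_in[OF g] _ f])
      fix z :: complex assume z: "z \<in> ball 0 1"
      show "\<langle>S g, ?K z\<rangle> = \<langle>g, T (?K z)\<rangle>"
        using kernel_left[OF z g] inner_commute[OF K_in[OF z] S_in[OF g]]
          inner_commute[OF T_in[OF K_in[OF z]] g] by simp
    qed
    then show ?thesis
      using inner_commute[OF S_in[OF g] f] inner_commute[OF g T_in[OF f]] by simp
  qed
  then show ?thesis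
    using S_in by (simp add: is_adjoint_def)
qed

lemma self_adjoint_iff_hermitian_on_kernels:
  assumes T: "bounded_operator \<alpha> T"
  shows "self_adjoint \<alpha> T \<longleftrightarrow> hermitian_on (ball 0 1) (\<lambda>z w. T (reproducing_kernel w 0) z)"
proof
  let ?K = "\<lambda>w. reproducing_kernel w 0"
  assume self_adjoint: "self_adjoint \<alpha> T"
  note K_in = reproducing_kernel_in_space[where m = 0]
  note TK_in = bounded_operator_in_space[OF T K_in]
  show "hermitian_on (ball 0 1) (\<lambda>z w. T (?K w) z)"
    unfolding hermitian_on_def
  proof (intro ballI)
    fix z w :: complex assume z: "z \<in> ball 0 1" and w: "w \<in> ball 0 1"
    have "\<langle>T (?K w), ?K z\<rangle> = \<langle>?K w, T (?K z)\<rangle>"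
      using self_adjoint K_in z w by (simp add: self_adjoint_def is_adjoint_def)
    also have "\<dots> = cnj \<langle>T (?K z), ?K w\<rangle>"
      by (rule inner_commute[OF TK_in[OF z] K_in[OF w]])
    finally show "T (?K w) z = cnj (T (?K z) w)"
      by (simp only: inner_reproducing_kernel_0 TK_in K_in z w)
  qed
next
  assume "hermitian_on (ball 0 1) (\<lambda>z w. T (reproducing_kernel w 0) z)"
  then have "is_adjoint \<alpha> T T"
    by (intro is_adjointI_kernels T) (rule hermitian_onD)
  with T show "self_adjoint \<alpha> T"
    by (simp add: self_adjoint_def)
qed

lemma comp_diff_op_reproducing_kernel:
  assumes "\<phi> z \<in> ball 0 1" and z: "z \<in> ball 0 1" and w: "w \<in> ball 0 1"
  shows "comp_diff_op \<psi> \<phi> n (reproducing_kernel w 0) z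
    = of_real (pochhammer (\<alpha> + 2) n) * symbol_kernel (real n + \<alpha> + 2) n \<psi> \<phi> z w"
  using z w higher_deriv_reproducing_kernel_0[OF w assms(1), of n] cnj_kernel_denom[OF assms(1) w]
  by (simp add: comp_diff_op_def reproducing_kernel_def symbol_kernel_def mult_ac)

lemma self_adjoint_comp_diff_op_iff:
  assumes T: "bounded_operator \<alpha> (comp_diff_op \<psi> \<phi> n)" and maps: "\<phi> ` ball 0 1 \<subseteq> ball 0 1"
  shows "self_adjoint \<alpha> (comp_diff_op \<psi> \<phi> n) \<longleftrightarrow>
    hermitian_on (ball 0 1) (symbol_kernel (real n + \<alpha> + 2) n \<psi> \<phi>)"
proof -
  have "comp_diff_op \<psi> \<phi> n (reproducing_kernel w 0) z
      = of_real (pochhammer (\<alpha> + 2) n) * symbol_kernel (real n + \<alpha> + 2) n \<psi> \<phi> z w"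
    if "z \<in> ball 0 1" "w \<in> ball 0 1" for z w
    using maps that by (intro comp_diff_op_reproducing_kernel) (auto simp: image_subset_iff)
  then show ?thesis
    using pochhammer_alpha_pos[of n] unfolding self_adjoint_iff_hermitian_on_kernels[OF T]
    by (simp add: hermitian_on_def)
qed

end

section \<open>The conjugations\<close>

abbreviation rotation_conj :: "complex \<Rightarrow> operator" where
  "rotation_conj \<mu> \<equiv> rotation_op \<mu> \<circ> J_op"

lemma rotation_conj_apply: "rotation_conj \<mu> f z = cnj (f (cnj (\<mu> * z)))"
  by (simp add: rotation_op_def J_op_def)

lemma rotation_conj_1: "rotation_conj 1 = J_op"
  by (simp add: rotation_op_def fun_eq_iff)

lemma J_op_holomorphic:
  assumes "f holomorphic_on ball 0 r"
  shows "J_op f holomorphic_on ball 0 r"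
proof -
  have "f holomorphic_on cnj ` ball 0 r"
    using assms by (rule holomorphic_on_subset) auto
  then show ?thesis
    using holomorphic_on_compose_cnj_cnj[of f "ball 0 r"] by (simp add: J_op_def comp_def)
qed

lemma rotation_conj_holomorphic:
  assumes f: "f holomorphic_on ball 0 r" and \<mu>: "cmod \<mu> = 1"
  shows "rotation_conj \<mu> f holomorphic_on ball 0 r"
proof -
  have "J_op f holomorphic_on (\<lambda>z. \<mu> * z) ` ball 0 r"
    using \<mu> by (intro holomorphic_on_subset[OF J_op_holomorphic[OF f]]) (auto simp: norm_mult)
  then have "J_op f \<circ> (\<lambda>z. \<mu> * z) holomorphic_on ball 0 r"
    by (intro holomorphic_on_compose holomorphic_intros)
  then show ?thesis
    by (simp add: rotation_op_def[abs_def] comp_def)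
qed

lemma higher_deriv_rotation_conj:
  assumes f: "f holomorphic_on ball 0 r" and \<mu>: "cmod \<mu> = 1" and z: "z \<in> ball 0 r"
  shows "(deriv ^^ m) (rotation_conj \<mu> f) z = \<mu> ^ m * cnj ((deriv ^^ m) f (cnj (\<mu> * z)))"
proof -
  have "(deriv ^^ m) (rotation_conj \<mu> f) z = (deriv ^^ m) (\<lambda>w. J_op f (\<mu> * w)) z"
    by (simp add: rotation_op_def[abs_def])
  also have "\<dots> = \<mu> ^ m * (deriv ^^ m) (J_op f) (\<mu> * z)"
    using z \<mu>
    by (intro higher_deriv_compose_linear[OF J_op_holomorphic[OF f] open_ball[of 0 r] open_ball])
      (auto simp: norm_mult)
  also have "(deriv ^^ m) (J_op f) (\<mu> * z) = cnj ((deriv ^^ m) f (cnj (\<mu> * z)))"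
    unfolding J_op_def[abs_def]
    using z \<mu> by (intro higher_deriv_cnj_cnj[OF f]) (auto simp: norm_mult)
  finally show ?thesis .
qed

lemma norm_taylor_coeff_rotation_conj:
  assumes "f holomorphic_on ball 0 r" "r > 0" and "cmod \<mu> = 1"
  shows "cmod (taylor_coeff (rotation_conj \<mu> f) j) = cmod (taylor_coeff f j)"
  using higher_deriv_rotation_conj[OF assms(1,3), of 0 j] assms(2,3)
  by (simp add: taylor_coeff_def norm_mult norm_power norm_divide)

lemma cnj_mult_self_eq_1: "cmod \<mu> = 1 \<Longrightarrow> cnj \<mu> * \<mu> = 1"
  using complex_norm_square[of \<mu>] by (simp add: mult.commute)

lemma rotation_conj_involution:
  assumes "cmod \<mu> = 1"
  shows "rotation_conj \<mu> (rotation_conj \<mu> f) = f"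
proof
  fix z
  have "cnj \<mu> * (\<mu> * z) = z"
    using cnj_mult_self_eq_1[OF assms] by (simp flip: mult.assoc)
  then show "rotation_conj \<mu> (rotation_conj \<mu> f) z = f z"
    by (simp only: rotation_conj_apply complex_cnj_mult complex_cnj_cnj)
qed

lemma conjugation_rotation_conj:
  assumes \<mu>: "cmod \<mu> = 1"
  shows "conjugation \<alpha> (rotation_conj \<mu>)"
proof -
  have coeff: "cmod (taylor_coeff (rotation_conj \<mu> f) j) = cmod (taylor_coeff f j)"
    if "f \<in> bergman_space \<alpha>" for f j
    by (rule norm_taylor_coeff_rotation_conj[OF bergman_space_holomorphic[OF that] zero_less_one \<mu>])
  have "rotation_conj \<mu> f \<in> bergman_space \<alpha>" if f: "f \<in> bergman_space \<alpha>" for f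
  proof -
    have "rotation_conj \<mu> f z = 0" if "z \<notin> ball 0 1" for z
      using bergman_space_outside[OF f, of "cnj (\<mu> * z)"] that \<mu>
      unfolding rotation_conj_apply by (simp add: norm_mult)
    then show ?thesis
      using f coeff[OF f] rotation_conj_holomorphic[OF bergman_space_holomorphic[OF f] \<mu>]
      by (simp add: bergman_space_def)
  qed
  moreover have "bergman_norm \<alpha> (rotation_conj \<mu> f) = bergman_norm \<alpha> f"
    if "f \<in> bergman_space \<alpha>" for f
    by (simp only: bergman_norm_def coeff[OF that])
  ultimately show ?thesis
    using rotation_conj_involution[OF \<mu>] unfolding conjugation_def
    by (auto simp: rotation_op_def J_op_def)
qed

lemma C_symmetric_comp_diff_op:
  assumes self_adjoint: "self_adjoint \<alpha> (comp_diff_op \<psi> \<phi> n)" and maps: "\<phi> ` ball 0 1 \<subseteq> ball 0 1"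
    and \<mu>: "cmod \<mu> = 1"
    and \<psi>: "\<And>z. z \<in> ball 0 1 \<Longrightarrow> cnj (\<mu> ^ n * \<psi> (cnj (\<mu> * z))) = \<psi> z"
    and \<phi>: "\<And>z. z \<in> ball 0 1 \<Longrightarrow> cnj (\<mu> * \<phi> (cnj (\<mu> * z))) = \<phi> z"
  shows "C_symmetric \<alpha> (rotation_conj \<mu>) (comp_diff_op \<psi> \<phi> n)"
proof -
  let ?T = "comp_diff_op \<psi> \<phi> n" and ?C = "rotation_conj \<mu>"
  have "?C (?T (?C f)) z = ?T f z" if f: "f \<in> bergman_space \<alpha>" for f z
  proof (cases "z \<in> ball 0 1")
    case True
    let ?z = "cnj (\<mu> * z)"
    have z: "?z \<in> ball 0 1" using True \<mu> by (simp add: norm_mult)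
    then have "\<phi> ?z \<in> ball 0 1" using maps by blast
    note deriv = higher_deriv_rotation_conj[OF bergman_space_holomorphic[OF f] \<mu> this, of n]
    have "?T (?C f) ?z = \<psi> ?z * (\<mu> ^ n * cnj ((deriv ^^ n) f (\<phi> z)))"
      using z unfolding comp_diff_op_def deriv \<phi>[OF True] by simp
    then have "?C (?T (?C f)) z = cnj (\<mu> ^ n * \<psi> ?z) * (deriv ^^ n) f (\<phi> z)"
      unfolding rotation_conj_apply[of \<mu> "?T (?C f)"] by (simp add: mult_ac)
    then show ?thesis
      using True unfolding \<psi>[OF True] by (simp add: comp_diff_op_def)
  next
    case False
    then show ?thesis
      unfolding rotation_conj_apply[of \<mu> "?T (?C f)"]
      using \<mu> by (simp add: comp_diff_op_def norm_mult)
  qed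
  then have "\<forall>f\<in>bergman_space \<alpha>. ?C (?T (?C f)) = ?T f"
    by blast
  then show ?thesis
    using self_adjoint conjugation_rotation_conj[OF \<mu>]
    unfolding C_symmetric_def self_adjoint_def by blast
qed

lemma weight_symbol_rotation_conj:
  assumes \<mu>: "cmod \<mu> = 1" "\<mu> * c = cnj c" and c_in_ball: "c \<in> ball 0 1"
    and "L \<in> \<real>" and z: "z \<in> ball 0 1"
  shows "cnj (\<mu> ^ n * weight_symbol s n L c (cnj (\<mu> * z))) = weight_symbol s n L c z"
proof -
  have "cnj (\<mu> * z) \<in> ball 0 1" using z \<mu>(1) by (simp add: norm_mult)
  then have "cnj (kernel_denom s c (cnj (\<mu> * z))) = kernel_denom s (cnj (\<mu> * z)) c"
    by (rule cnj_kernel_denom[OF c_in_ball])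
  also have "\<mu> * z * c = cnj c * z"
    by (simp only: \<mu>(2)[symmetric] mult_ac)
  then have "kernel_denom s (cnj (\<mu> * z)) c = kernel_denom s c z"
    by (simp only: kernel_denom_def complex_cnj_cnj)
  finally have "cnj (\<mu> ^ n * weight_symbol s n L c (cnj (\<mu> * z)))
      = (cnj \<mu> * \<mu>) ^ n * weight_symbol s n L c z"
    using \<open>L \<in> \<real>\<close> by (simp add: weight_symbol_def Reals_cnj_iff power_mult_distrib)
  also have "cnj \<mu> * \<mu> = 1"
    by (rule cnj_mult_self_eq_1[OF \<mu>(1)])
  finally show ?thesis by simp
qed

lemma moebius_symbol_rotation_conj:
  assumes \<mu>: "cmod \<mu> = 1" "\<mu> * c = cnj c" and "b \<in> \<real>"
  shows "cnj (\<mu> * moebius_symbol c b (cnj (\<mu> * z))) = moebius_symbol c b z"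
proof -
  have "c * (\<mu> * z) = cnj c * z"
    by (simp only: \<mu>(2)[symmetric] mult_ac)
  moreover have "cnj \<mu> * cnj c = c"
    using arg_cong[OF \<mu>(2), of cnj] by simp
  ultimately have "cnj (\<mu> * moebius_symbol c b (cnj (\<mu> * z)))
      = c + (cnj \<mu> * \<mu>) * (b * z / (1 - cnj c * z))"
    using \<open>b \<in> \<real>\<close> by (simp add: moebius_symbol_def Reals_cnj_iff distrib_left mult_ac)
  also have "cnj \<mu> * \<mu> = 1"
    by (rule cnj_mult_self_eq_1[OF \<mu>(1)])
  finally show ?thesis by (simp add: moebius_symbol_def)
qed

section \<open>Self-adjoint composition-differentiation operators\<close>

lemma prod_eq_pochhammer: "(\<Prod>k=1..n. \<alpha> + real k + 1) = pochhammer (\<alpha> + 2) n"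
  by (induction n) (simp_all add: pochhammer_Suc algebra_simps)

lemma exp_Arg2pi_mult_eq_cnj: "exp (- 2 * \<i> * of_real (Arg2pi c)) * c = cnj c"
proof -
  have polar: "c = of_real (cmod c) * exp (\<i> * of_real (Arg2pi c))"
    by (rule Arg2pi_eq)
  have "exp (- 2 * \<i> * of_real (Arg2pi c)) * c
      = of_real (cmod c) * (exp (- 2 * \<i> * of_real (Arg2pi c)) * exp (\<i> * of_real (Arg2pi c)))"
    by (subst (2) polar) (simp add: mult_ac)
  also have "\<dots> = of_real (cmod c) * exp (- (\<i> * of_real (Arg2pi c)))"
    by (simp flip: exp_add)
  also have "\<dots> = cnj c"
    by (subst (3) polar) (simp add: exp_cnj)
  finally show ?thesis .
qed

context weighted_bergman
begin

lemma weight_symbol_eq_bergman_kernel: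
  assumes "c \<in> ball 0 1" "z \<in> ball 0 1"
  shows "weight_symbol (real n + \<alpha> + 2) n L c z
    = L / of_real (pochhammer (\<alpha> + 2) n) * bergman_kernel \<alpha> c n z"
  using assms pochhammer_alpha_pos[of n]
  by (simp add: weight_symbol_def bergman_kernel_eq_reproducing_kernel reproducing_kernel_def)

lemma self_adjoint_comp_diff_op_iff_symbols:
  assumes T: "bounded_operator \<alpha> (comp_diff_op \<psi> \<phi> n)" and \<psi>: "\<exists>z\<in>ball 0 1. \<psi> z \<noteq> 0"
    and \<phi>: "\<phi> holomorphic_on ball 0 1" "\<phi> ` ball 0 1 \<subseteq> ball 0 1" "\<not> \<phi> constant_on ball 0 1"
  shows "self_adjoint \<alpha> (comp_diff_op \<psi> \<phi> n) \<longleftrightarrow>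
    (\<forall>z\<in>ball 0 1. \<psi> z = weight_symbol (real n + \<alpha> + 2) n (taylor_coeff \<psi> n) (\<phi> 0) z \<and>
      \<phi> z = moebius_symbol (\<phi> 0) (deriv \<phi> 0) z) \<and>
    taylor_coeff \<psi> n \<in> \<real> - {0} \<and> deriv \<phi> 0 \<in> \<real> - {0}"
proof -
  have exponent_nonzero: "real n + \<alpha> + 2 \<noteq> 0" using alpha by linarith
  have "taylor_coeff \<psi> n \<noteq> 0"
    if "\<forall>z\<in>ball 0 1. \<psi> z = weight_symbol (real n + \<alpha> + 2) n (taylor_coeff \<psi> n) (\<phi> 0) z"
    using \<psi> that by (auto simp: weight_symbol_def)
  moreover have "deriv \<phi> 0 \<noteq> 0" if "\<forall>z\<in>ball 0 1. \<phi> z = moebius_symbol (\<phi> 0) (deriv \<phi> 0) z"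
  proof
    assume "deriv \<phi> 0 = 0"
    then have "moebius_symbol (\<phi> 0) (deriv \<phi> 0) z = \<phi> 0" for z
      by (simp add: moebius_symbol_def)
    then have "\<forall>z\<in>ball 0 1. \<phi> z = \<phi> 0"
      using that by metis
    then show False
      using \<phi>(3) unfolding constant_on_def by blast
  qed
  ultimately show ?thesis
    unfolding self_adjoint_comp_diff_op_iff[OF T \<phi>(2)]
      hermitian_symbol_kernel_iff[OF exponent_nonzero \<psi> \<phi>(1,2)]
    by blast
qed

lemma C_symmetric_rotation_conj_comp_diff_op:
  assumes self_adjoint: "self_adjoint \<alpha> (comp_diff_op \<psi> \<phi> n)" and \<psi>: "\<exists>z\<in>ball 0 1. \<psi> z \<noteq> 0"
    and \<phi>: "\<phi> holomorphic_on ball 0 1" "\<phi> ` ball 0 1 \<subseteq> ball 0 1" "\<not> \<phi> constant_on ball 0 1"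
    and \<mu>: "cmod \<mu> = 1" "\<mu> * \<phi> 0 = cnj (\<phi> 0)"
  shows "C_symmetric \<alpha> (rotation_conj \<mu>) (comp_diff_op \<psi> \<phi> n)"
proof (rule C_symmetric_comp_diff_op[OF self_adjoint \<phi>(2) \<mu>(1)])
  have "bounded_operator \<alpha> (comp_diff_op \<psi> \<phi> n)"
    using self_adjoint by (simp add: self_adjoint_def)
  note symbols = self_adjoint[unfolded self_adjoint_comp_diff_op_iff_symbols[OF this \<psi> \<phi>]]
  have real: "taylor_coeff \<psi> n \<in> \<real>" "deriv \<phi> 0 \<in> \<real>"
    using symbols by blast+
  have \<psi>_eq: "\<psi> u = weight_symbol (real n + \<alpha> + 2) n (taylor_coeff \<psi> n) (\<phi> 0) u"
    and \<phi>_eq: "\<phi> u = moebius_symbol (\<phi> 0) (deriv \<phi> 0) u" if "u \<in> ball 0 1" for u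
    using symbols that by blast+
  have \<phi>0_in_ball: "\<phi> 0 \<in> ball 0 1" using \<phi>(2) by (auto simp: image_subset_iff)
  fix z :: complex assume z: "z \<in> ball 0 1"
  then have rotated: "cnj (\<mu> * z) \<in> ball 0 1" using \<mu>(1) by (simp add: norm_mult)
  show "cnj (\<mu> ^ n * \<psi> (cnj (\<mu> * z))) = \<psi> z"
    unfolding \<psi>_eq[OF z] \<psi>_eq[OF rotated]
    by (rule weight_symbol_rotation_conj[OF \<mu> \<phi>0_in_ball real(1) z])
  show "cnj (\<mu> * \<phi> (cnj (\<mu> * z))) = \<phi> z"
    unfolding \<phi>_eq[OF z] \<phi>_eq[OF rotated]
    by (rule moebius_symbol_rotation_conj[OF \<mu> real(2)])
qed

end

theorem proposition3p1:
  fixes \<alpha> :: real and n :: nat and \<psi> \<phi> :: "complex \<Rightarrow> complex"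
    and a b c :: complex and t \<theta> :: real
  assumes "\<alpha> > -1" and "n > 0"
    and "\<psi> holomorphic_on ball 0 1" and "\<exists>z\<in>ball 0 1. \<psi> z \<noteq> 0"
    and "\<phi> holomorphic_on ball 0 1" and "\<phi> ` ball 0 1 \<subseteq> ball 0 1"
    and "\<not> \<phi> constant_on ball 0 1"
    and "bounded_operator \<alpha> (comp_diff_op \<psi> \<phi> n)"
    and "a = (deriv ^^ n) \<psi> 0" and "b = deriv \<phi> 0" and "c = \<phi> 0"
    and "t = (\<Prod>k=1..n. \<alpha> + real k + 1)" and "\<theta> = Arg2pi c"
  shows "(self_adjoint \<alpha> (comp_diff_op \<psi> \<phi> n) \<longleftrightarrow>
            (\<forall>z\<in>ball 0 1.
               \<psi> z = a * z ^ n / (fact n * (1 - cnj c * z) powr of_real (real n + \<alpha> + 2)) \<and>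
               \<psi> z = a / (of_real t * fact n) * bergman_kernel \<alpha> c n z \<and>
               \<phi> z = c + b * z / (1 - cnj c * z)) \<and>
            a \<in> \<real> \<and> a \<noteq> 0 \<and> b \<in> \<real> \<and> b \<noteq> 0 \<and> c \<in> ball 0 1) \<and>
         (self_adjoint \<alpha> (comp_diff_op \<psi> \<phi> n) \<longrightarrow>
            (c = 0 \<longrightarrow> C_symmetric \<alpha> J_op (comp_diff_op \<psi> \<phi> n)) \<and>
            (c \<noteq> 0 \<longrightarrow> C_symmetric \<alpha> (rotation_op (exp (- 2 * \<i> * of_real \<theta>)) \<circ> J_op)
               (comp_diff_op \<psi> \<phi> n)))"
proof -
  interpret weighted_bergman \<alpha> by unfold_locales fact
  let ?T = "comp_diff_op \<psi> \<phi> n" and ?\<psi> = "weight_symbol (real n + \<alpha> + 2) n (a / fact n) c"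
  have c_in_ball: "c \<in> ball 0 1"
    using assms(6,11) by (auto simp: image_subset_iff)
  have formulas: "a * z ^ n / (fact n * (1 - cnj c * z) powr of_real (real n + \<alpha> + 2)) = ?\<psi> z"
    "z \<in> ball 0 1 \<Longrightarrow> a / (of_real t * fact n) * bergman_kernel \<alpha> c n z = ?\<psi> z"
    "c + b * z / (1 - cnj c * z) = moebius_symbol c b z" for z
    by (simp_all only: weight_symbol_eq_bergman_kernel[OF c_in_ball] assms(12) prod_eq_pochhammer)
      (simp_all add: weight_symbol_def kernel_denom_def moebius_symbol_def mult.commute)
  have self_adjoint_iff: "self_adjoint \<alpha> ?T \<longleftrightarrow>
      (\<forall>z\<in>ball 0 1. \<psi> z = ?\<psi> z \<and> \<phi> z = moebius_symbol c b z) \<and>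
      a \<in> \<real> \<and> a \<noteq> 0 \<and> b \<in> \<real> \<and> b \<noteq> 0"
    using self_adjoint_comp_diff_op_iff_symbols[OF assms(8,4-7)]
    by (simp add: taylor_coeff_def Reals_cnj_iff flip: assms(9-11))
  note C_symmetric = C_symmetric_rotation_conj_comp_diff_op[OF _ assms(4-7), folded assms(11)]
  have "C_symmetric \<alpha> J_op ?T" if "self_adjoint \<alpha> ?T" "c = 0"
    using C_symmetric[of n 1] that by (simp add: rotation_conj_1)
  moreover have "C_symmetric \<alpha> (rotation_conj (exp (- 2 * \<i> * of_real \<theta>))) ?T"
    if "self_adjoint \<alpha> ?T"
    unfolding assms(13) by (rule C_symmetric[OF that _ exp_Arg2pi_mult_eq_cnj]) simp
  ultimately show ?thesis
    using self_adjoint_iff c_in_ball by (simp (no_asm) only: formulas cong: ball_cong) blast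
qed

end
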